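(* Let $\mathcal{C}=\mathrm{Corridor}(u,l,D)$ be an $\mathbb{R}^m$-corridor, let $X\subset D$ be a finite set, and let $H=(X,E)$ be an incompatibility hypergraph for $\mathcal{C}$. Then the optimal value of problem $(\mathcal{R}^{\mathrm{color}})$, i.e. the minimum $n$ such that $H$ admits an $n$-coloring, is a lower bound on the optimal value of the Corridor Fitting Problem in $\mathbb{R}^m$ on $\mathcal{C}$, i.e. on the minimum number of pieces of a piecewise linear function $g$ with domain $D$ satisfying $l(x)\le g(x)\le u(x)$ for all $x\in D$.
   Context: "Linear function" means affine function $x\mapsto a^Tx+b$ with $a\in\mathbb{R}^m$, $b\in\mathbb{R}$. Polytopes are compact; $\mathrm{int}$, $\mathrm{bd}$ and $\mathrm{conv}$ denote interior, boundary and convex hull. Corridor: let $D\subset\mathbb{R}^m$ be a full-dimensional polytope and $u,l:D\to\mathbb{R}$ continuous functions with $l(x)<u(x)$ for all $x\in D$. The $\mathbb{R}^m$-corridor between $u$ and $l$ of domain $D$ is $\mathrm{Corridor}(u,l,D)=\{(x,z)\in\mathbb{R}^{m+1} : x\in D,\ l(x)\le z\le u(x)\}$ (given together with the data $u,l,D$). Piecewise linear function with $n$ pieces and domain $D$ ($n\ge 1$ an integer): given full-dimensional polytopes $D_1,\dots,D_n\subset\mathbb{R}^m$ covering $D$ with pairwise disjoint interiors, and linear functions $l_i:D_i\to\mathbb{R}$, it is the function $g$ on $D$ with $g(x)=l_i(x)$ if $x\in\mathrm{int}(D_i)$, and, if $x$ lies on the boundary of some $D_i$, $g(x)=\min\{l_i(x):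 i \text{ with } x\in D_i\}$. Corridor Fitting Problem in $\mathbb{R}^m$ ($\mathbb{R}^m$-CFP) on $\mathrm{Corridor}(u,l,D)$: find a piecewise linear function $g$ with domain $D$ with the minimum number $n$ of pieces subject to $l(x)\le g(x)\le u(x)$ for all $x\in D$. Its optimal value is this minimum number of pieces. Linearly compatible set: a finite set $s\subset D$ is linearly compatible (for $\mathrm{Corridor}(u,l,D)$) if there is a linear function $L$ with $l(x)\le L(x)\le u(x)$ for all $x\in\mathrm{conv}(s)$; otherwise it is not linearly compatible. Hypergraph and coloring: a hypergraph $(V,E)$ has a finite vertex set $V$ and a set $E$ of edges, each edge being a subset of $V$ (possibly with more than two vertices). An $n$-coloring of $(V,E)$ is a function $c:V\to\{1,\dots,n\}$ such that for every edge $e\in E$ not all vertices of $e$ have the same color. Incompatibility hypergraph for $\mathcal{C}$: a hypergraph $H=(X,E)$ with $X\subset D$ finite, each of whose edges is a subset of $X$ that is not linearly compatible for $\mathcal{C}$ (not every such subset needs to be an edge). Problem $(\mathcal{R}^{\mathrm{color}})$: the hypergraph coloring problem applied to $H$, i.e. color $H$ with the minimum number of colors. *)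

theory Defs
  imports "HOL-Analysis.Analysis" "HOL-Library.Extended_Nat"
begin

text \<open>``Linear'' here means affine.\<close>

definition linear_function :: "(real ^ 'm \<Rightarrow> real) \<Rightarrow> bool" where
  "linear_function L \<longleftrightarrow> (\<exists>a b. \<forall>x. L x = a \<bullet> x + b)"

definition full_dim_polytope :: "(real ^ 'm) set \<Rightarrow> bool" where
  "full_dim_polytope P \<longleftrightarrow> polytope P \<and> aff_dim P = int CARD('m)"


subsection \<open>Corridors\<close>

text \<open>A corridor always comes with its data \<open>u\<close>, \<open>l\<close>, \<open>D\<close>, so the notions below take these as
  arguments instead of the point set \<open>Corridor u l D\<close>. The functions \<open>u\<close>, \<open>l\<close>, \<open>g\<close> are total in
  HOL, but only their values on \<open>D\<close> matter.\<close>

definition is_corridor :: "(real ^ 'm \<Rightarrow> real) \<Rightarrow> (real ^ 'm \<Rightarrow> real) \<Rightarrow> (real ^ 'm) set \<Rightarrow> bool" where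
  "is_corridor u l D \<longleftrightarrow> full_dim_polytope D \<and> continuous_on D u \<and> continuous_on D l \<and>
     (\<forall>x\<in>D. l x < u x)"

definition Corridor ::
  "(real ^ 'm \<Rightarrow> real) \<Rightarrow> (real ^ 'm \<Rightarrow> real) \<Rightarrow> (real ^ 'm) set \<Rightarrow> ((real ^ 'm) \<times> real) set" where
  "Corridor u l D = {(x, z). x \<in> D \<and> l x \<le> z \<and> z \<le> u x}"


subsection \<open>The corridor fitting problem\<close>

text \<open>\<open>piecewise_linear g n D\<close>: \<open>g\<close> is, on \<open>D\<close>, a piecewise linear function with \<open>n\<close> pieces.
  The pieces cover \<open>D\<close>; they are not required to be contained in \<open>D\<close>.\<close>

definition piecewise_linear :: "(real ^ 'm \<Rightarrow> real) \<Rightarrow> nat \<Rightarrow> (real ^ 'm) set \<Rightarrow> bool" where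
  "piecewise_linear g n D \<longleftrightarrow> n \<ge> 1 \<and>
     (\<exists>(P :: nat \<Rightarrow> (real ^ 'm) set) (L :: nat \<Rightarrow> real ^ 'm \<Rightarrow> real).
        (\<forall>i\<in>{1..n}. full_dim_polytope (P i) \<and> linear_function (L i)) \<and>
        D \<subseteq> (\<Union>i\<in>{1..n}. P i) \<and>
        (\<forall>i\<in>{1..n}. \<forall>j\<in>{1..n}. i \<noteq> j \<longrightarrow> interior (P i) \<inter> interior (P j) = {}) \<and>
        (\<forall>x\<in>D. (\<forall>i\<in>{1..n}. x \<in> interior (P i) \<longrightarrow> g x = L i x) \<and>
                ((\<exists>i\<in>{1..n}. x \<in> frontier (P i)) \<longrightarrow>
                   g x = Min {L i x | i. i \<in> {1..n} \<and> x \<in> P i})))"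

definition cfp_feasible ::
  "(real ^ 'm \<Rightarrow> real) \<Rightarrow> (real ^ 'm \<Rightarrow> real) \<Rightarrow> (real ^ 'm) set \<Rightarrow> nat \<Rightarrow> (real ^ 'm \<Rightarrow> real) \<Rightarrow> bool" where
  "cfp_feasible u l D n g \<longleftrightarrow> piecewise_linear g n D \<and> (\<forall>x\<in>D. l x \<le> g x \<and> g x \<le> u x)"

lemma cfp_feasible_iff_graph:
  "cfp_feasible u l D n g \<longleftrightarrow>
     piecewise_linear g n D \<and> (\<lambda>x. (x, g x)) ` D \<subseteq> Corridor u l D"
  by (auto simp: cfp_feasible_def Corridor_def)

text \<open>Optimal values are taken in \<^typ>\<open>enat\<close>: the infimum of a nonempty set is attained, and an
  infeasible minimisation problem has value \<open>\<infinity>\<close> (on \<^typ>\<open>nat\<close>, it would be \<open>0\<close>).\<close>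

definition cfp_opt ::
  "(real ^ 'm \<Rightarrow> real) \<Rightarrow> (real ^ 'm \<Rightarrow> real) \<Rightarrow> (real ^ 'm) set \<Rightarrow> enat" where
  "cfp_opt u l D = Inf {enat n | n. \<exists>g. cfp_feasible u l D n g}"


subsection \<open>Hypergraph colouring\<close>

definition hypergraph :: "'a set \<Rightarrow> 'a set set \<Rightarrow> bool" where
  "hypergraph V E \<longleftrightarrow> finite V \<and> (\<forall>e\<in>E. e \<subseteq> V)"

definition is_coloring :: "'a set \<Rightarrow> 'a set set \<Rightarrow> nat \<Rightarrow> ('a \<Rightarrow> nat) \<Rightarrow> bool" where
  "is_coloring V E n c \<longleftrightarrow> c \<in> V \<rightarrow> {1..n} \<and> (\<forall>e\<in>E. \<not> (\<forall>v\<in>e. \<forall>w\<in>e. c v = c w))"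

definition color_opt :: "'a set \<Rightarrow> 'a set set \<Rightarrow> enat" where
  "color_opt V E = Inf {enat n | n. \<exists>c. is_coloring V E n c}"


subsection \<open>Incompatibility hypergraphs\<close>

text \<open>To be used for finite \<open>s \<subseteq> D\<close> only. This side condition is deliberately not part of the
  definition, which is used negated below.\<close>

definition linearly_compatible ::
  "(real ^ 'm \<Rightarrow> real) \<Rightarrow> (real ^ 'm \<Rightarrow> real) \<Rightarrow> (real ^ 'm) set \<Rightarrow> bool" where
  "linearly_compatible u l s \<longleftrightarrow>
     (\<exists>L. linear_function L \<and> (\<forall>x \<in> convex hull s. l x \<le> L x \<and> L x \<le> u x))"

definition incompatibility_hypergraph ::
  "(real ^ 'm \<Rightarrow> real) \<Rightarrow> (real ^ 'm \<Rightarrow> real) \<Rightarrow> (real ^ 'm) set \<Rightarrow>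
     (real ^ 'm) set \<Rightarrow> (real ^ 'm) set set \<Rightarrow> bool" where
  "incompatibility_hypergraph u l D X E \<longleftrightarrow>
     hypergraph X E \<and> X \<subseteq> D \<and> (\<forall>e\<in>E. \<not> linearly_compatible u l e)"

end

theory Submission imports Defs begin

text \<open>A fitting function with \<open>n\<close> pieces \<open>P i\<close> yields an \<open>n\<close>-coloring: color each point of
  \<open>X\<close> by a piece that contains it. If an edge \<open>e\<close> were monochromatic, of color \<open>i\<close> say, then its
  convex hull would lie in \<open>P i \<inter> D\<close>, and the affine function \<open>L i\<close> of that piece would witness
  the linear compatibility of \<open>e\<close>.

  The witness needs \<open>l \<le> L i \<le> u\<close> on all of \<open>P i \<inter> D\<close>, whereas the fitting function, to which
  feasibility applies, is only sure to agree with \<open>L i\<close> on \<open>interior (P i) \<inter> D\<close>; elsewhere its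
  value may come from another piece. The bounds pass to the closure by continuity, and if
  \<open>P i \<inter> D\<close> has interior points, it is the closure of its interior (lemma
  \<open>piece_fits_on_overlap\<close>). A piece that meets \<open>D\<close> only in boundary points of \<open>D\<close> carries no
  such information, so it must not be used as a color. The remaining pieces still cover \<open>D\<close>,
  because they cover the dense subset \<open>interior D\<close> and their union is closed (lemma
  \<open>overlapping_pieces_cover\<close>).\<close>

lemma full_dim_polytope_imp_convex_closed:
  assumes "full_dim_polytope P"
  shows "convex P" "closed P"
  using assms by (auto simp: full_dim_polytope_def polytope_imp_convex polytope_imp_closed)

lemma closure_interior_full_dim_polytope:
  fixes P :: "(real ^ 'm) set"
  assumes "full_dim_polytope P"
  shows "closure (interior P) = P"
proof -
  have dim: "aff_dim P = int CARD('m)"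
    using assms by (simp add: full_dim_polytope_def)
  then have "P \<noteq> {}"
    by auto
  moreover have "rel_interior P = interior P"
    using dim aff_dim_eq_full[of P] by (intro rel_interior_interior) simp
  ultimately have "interior P \<noteq> {}"
    using rel_interior_eq_empty full_dim_polytope_imp_convex_closed[OF assms] by metis
  then show ?thesis
    using full_dim_polytope_imp_convex_closed[OF assms] by (simp add: convex_closure_interior)
qed

lemma linear_function_continuous_on:
  assumes "linear_function L"
  shows "continuous_on S L"
proof -
  obtain a b where "L = (\<lambda>x. a \<bullet> x + b)"
    using assms by (auto simp: linear_function_def)
  then show ?thesis
    by (auto intro!: continuous_intros)
qed

lemma piece_fits_on_overlap:
  fixes u l L :: "real ^ 'm \<Rightarrow> real"
  assumes cont: "continuous_on D u" "continuous_on D l" and L: "linear_function L"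
    and D: "convex D" "closed D" and P: "convex P" "closed P"
    and overlap: "interior P \<inter> interior D \<noteq> {}"
    and fits: "\<And>x. x \<in> interior P \<inter> interior D \<Longrightarrow> l x \<le> L x \<and> L x \<le> u x"
    and x: "x \<in> P \<inter> D"
  shows "l x \<le> L x \<and> L x \<le> u x"
proof -
  have cl: "closure (interior P \<inter> interior D) = P \<inter> D"
    using convex_closure_interior[of "P \<inter> D"] D P overlap by (simp add: convex_Int closed_Int)
  have contPD: "continuous_on (P \<inter> D) u" "continuous_on (P \<inter> D) l"
    using cont by (auto intro: continuous_on_subset)
  have contcl: "continuous_on (closure (interior P \<inter> interior D)) (\<lambda>x. L x - l x)"
    "continuous_on (closure (interior P \<inter> interior D)) (\<lambda>x. u x - L x)"
    unfolding cl by (intro continuous_on_diff contPD linear_function_continuous_on[OF L])+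
  have xcl: "x \<in> closure (interior P \<inter> interior D)"
    using x cl by simp
  have "0 \<le> L x - l x"
    by (rule continuous_ge_on_closure[OF contcl(1) xcl]) (use fits in force)
  moreover have "0 \<le> u x - L x"
    by (rule continuous_ge_on_closure[OF contcl(2) xcl]) (use fits in force)
  ultimately show ?thesis
    by simp
qed

text \<open>A full-dimensional polytope is the closure of its interior, so if that interior misses the
  open set \<open>interior D\<close>, then so does the whole polytope. The discarded sets thus contribute
  nothing to the cover of \<open>interior D\<close>, which is dense in \<open>D\<close>.\<close>

lemma overlapping_pieces_cover:
  fixes P :: "'i \<Rightarrow> (real ^ 'm) set"
  assumes I: "finite I" and P: "\<And>i. i \<in> I \<Longrightarrow> full_dim_polytope (P i)"
    and D: "full_dim_polytope D" and cover: "D \<subseteq> (\<Union>i\<in>I. P i)"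
  shows "D \<subseteq> (\<Union>i\<in>{i \<in> I. interior (P i) \<inter> interior D \<noteq> {}}. P i)" (is "_ \<subseteq> ?U")
proof -
  have "i \<in> I \<and> interior (P i) \<inter> interior D \<noteq> {}"
    if "i \<in> I" "x \<in> P i" "x \<in> interior D" for i x
    using that closure_interior_full_dim_polytope[OF P[OF \<open>i \<in> I\<close>]]
      open_Int_closure_eq_empty[of "interior D" "interior (P i)"] by auto
  then have "interior D \<subseteq> ?U"
    using cover interior_subset[of D] by fastforce
  moreover have "closed ?U"
    using I P by (intro closed_UN) (auto simp: full_dim_polytope_imp_convex_closed)
  ultimately show ?thesis
    using closure_minimal[of "interior D" ?U]
    by (simp only: closure_interior_full_dim_polytope[OF D])
qed

lemma coloring_of_cfp_feasible:
  fixes u l :: "real ^ 'm \<Rightarrow> real"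
  assumes corridor: "is_corridor u l D" and H: "incompatibility_hypergraph u l D X E"
    and feasible: "cfp_feasible u l D n g"
  obtains c where "is_coloring X E n c"
proof -
  have D: "full_dim_polytope D" and cont: "continuous_on D u" "continuous_on D l"
    using corridor by (auto simp: is_corridor_def)
  have X: "X \<subseteq> D" and E: "\<And>e. e \<in> E \<Longrightarrow> e \<subseteq> X \<and> \<not> linearly_compatible u l e"
    using H by (auto simp: incompatibility_hypergraph_def hypergraph_def)
  obtain P L where pieces: "\<forall>i\<in>{1..n}. full_dim_polytope (P i) \<and> linear_function (L i)"
    and cover: "D \<subseteq> (\<Union>i\<in>{1..n}. P i)"
    and g: "\<forall>x\<in>D. (\<forall>i\<in>{1..n}. x \<in> interior (P i) \<longrightarrow> g x = L i x) \<and>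
      ((\<exists>i\<in>{1..n}. x \<in> frontier (P i)) \<longrightarrow> g x = Min {L i x | i. i \<in> {1..n} \<and> x \<in> P i})"
    using feasible unfolding cfp_feasible_def piecewise_linear_def
    by (elim conjE exE) (rule that)
  have P: "full_dim_polytope (P i)" and L: "linear_function (L i)" if "i \<in> {1..n}" for i
    using pieces that by simp_all
  define J where "J = {i \<in> {1..n}. interior (P i) \<inter> interior D \<noteq> {}}"
  have "\<forall>x\<in>X. \<exists>i. i \<in> J \<and> x \<in> P i"
    using overlapping_pieces_cover[OF _ P D cover] X unfolding J_def by fastforce
  then obtain c where c: "\<And>x. x \<in> X \<Longrightarrow> c x \<in> J \<and> x \<in> P (c x)"
    by metis
  have "\<not> (\<forall>v\<in>e. \<forall>w\<in>e. c v = c w)" if "e \<in> E" for e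
  proof
    assume mono: "\<forall>v\<in>e. \<forall>w\<in>e. c v = c w"
    have "linear_function (\<lambda>x :: real ^ 'm. 0)"
      unfolding linear_function_def by (metis add_0 inner_zero_left)
    \<comment> \<open>The empty set is linearly compatible and hence not an edge, so the edge has a color.\<close>
    then have "e \<noteq> {}"
      using E[OF that] by (auto simp: linearly_compatible_def)
    then obtain v where v: "v \<in> e"
      by blast
    define i where "i = c v"
    have i: "i \<in> {1..n}" "interior (P i) \<inter> interior D \<noteq> {}"
      using c[of v] v E[OF that] unfolding i_def J_def by auto
    have "e \<subseteq> P i \<inter> D"
      using c mono v E[OF that] X unfolding i_def by (metis IntI subset_iff)
    then have hull: "convex hull e \<subseteq> P i \<inter> D"
      using full_dim_polytope_imp_convex_closed P[OF i(1)] D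
      by (intro hull_minimal) (auto intro: convex_Int)
    have fits: "l x \<le> L i x \<and> L i x \<le> u x" if "x \<in> interior (P i) \<inter> interior D" for x
    proof -
      have "x \<in> D"
        using that interior_subset by blast
      moreover from this have "g x = L i x"
        using g i(1) that by blast
      ultimately show ?thesis
        using feasible by (auto simp: cfp_feasible_def)
    qed
    note convex_closed = full_dim_polytope_imp_convex_closed[OF D]
      full_dim_polytope_imp_convex_closed[OF P[OF i(1)]]
    have "l x \<le> L i x \<and> L i x \<le> u x" if "x \<in> convex hull e" for x
      using piece_fits_on_overlap[OF cont L[OF i(1)] convex_closed i(2) fits] hull that
      by (meson subsetD)
    then show False
      using E[OF \<open>e \<in> E\<close>] L[OF i(1)] by (auto simp: linearly_compatible_def)
  qed
  then have "is_coloring X E n c"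
    using c by (auto simp: is_coloring_def J_def)
  then show thesis
    by (rule that)
qed

theorem proposition10:
  fixes u l :: "real ^ 'm \<Rightarrow> real"
    and D X :: "(real ^ 'm) set"
    and E :: "(real ^ 'm) set set"
  assumes "is_corridor u l D"
    and "finite X" and "X \<subseteq> D"
    and "incompatibility_hypergraph u l D X E"
  shows "color_opt X E \<le> cfp_opt u l D"
proof -
  have "\<exists>c. is_coloring X E n c" if "cfp_feasible u l D n g" for n g
    using coloring_of_cfp_feasible[OF assms(1,4) that] by metis
  then show ?thesis
    unfolding color_opt_def cfp_opt_def by (intro Inf_superset_mono) auto
qed

end
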